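(* Let $H$ be a separable real Hilbert space of dimension greater than or equal to $3$, with orthonormal basis $\{e_i\}$ and origin $\theta$. Let $T:H\to H$ be defined, for $x\in H$, by $$Tx=\begin{cases}\dfrac{\langle x,e_1\rangle^2-\langle x,e_2\rangle^2}{\sqrt{\langle x,e_1\rangle^2+\langle x,e_2\rangle^2}}\,e_1+\dfrac{2\langle x,e_1\rangle\langle x,e_2\rangle}{\sqrt{\langle x,e_1\rangle^2+\langle x,e_2\rangle^2}}\,e_2, & \text{if }\langle x,e_1\rangle^2+\langle x,e_2\rangle^2>0,\\[2mm] \theta, & \text{if }\langle x,e_1\rangle^2+\langle x,e_2\rangle^2=0.\end{cases}$$ For $z\in H$ write $z_1=\langle z,e_1\rangle$, $z_2=\langle z,e_2\rangle$, and, when $z_1^2+z_2^2>0$, let $D(z)$ be the (double-sequence) matrix whose upper-left $2\times2$ block is $$\frac{1}{(z_1^2+z_2^2)\sqrt{z_1^2+z_2^2}}\begin{pmatrix}(z_1^2+3z_2^2)z_1 & 2z_2^2z_2\\ -(3z_1^2+z_2^2)z_2 & 2z_1^2z_1\end{pmatrix}$$ and all of whose other entries are $0$; let $D(z)^T$ be its transpose. Then $T$ has the following properties. (i) $T$ is a nonexpansive mapping in the sense that $\|Tx\|_H\le\|x\|_H$ for any $x\in H$. (ii) $T$ is a (nonlinear) continuous quasi-Hilbert-Schmidt operator on $H$, and its Hilbert-Schmidt norm satisfies $\|T\|_{HS}^2=2$. (iii) Let $z\in H$ with $\langle z,e_1\rangle^2+\langle z,e_2\rangle^2>0$. Then $T$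 is Fréchet differentiable at $z$ and $$\nabla T(z)(x)=\operatorname{sc}(x)D(z)\begin{pmatrix} e_1 \\ e_2 \\ \vdots \end{pmatrix},\quad\text{for } x\in H.$$ (iv) Let $z\in H$ with $\langle z,e_1\rangle^2+\langle z,e_2\rangle^2>0$. Then $T$ is Mordukhovich differentiable at $z$ with $\widehat{D}^*T(z)=\nabla T(z)^*$, that is, $\widehat{D}^*T(z)(y)=\operatorname{sc}(y)D(z)^T\begin{pmatrix} e_1 \\ e_2 \\ \vdots \end{pmatrix}$ for any $y\in H$. More precisely, for $y\in H$, $$\widehat{D}^*T(z)(y)=\frac{\langle y,e_1\rangle(z_1^2+3z_2^2)z_1+2\langle y,e_2\rangle z_2^2z_2}{(z_1^2+z_2^2)\sqrt{z_1^2+z_2^2}}\,e_1+\frac{-\langle y,e_1\rangle(3z_1^2+z_2^2)z_2+2\langle y,e_2\rangle z_1^2z_1}{(z_1^2+z_2^2)\sqrt{z_1^2+z_2^2}}\,e_2.$$ (v) Let $z\in H$ with $\langle z,e_1\rangle^2+\langle z,e_2\rangle^2>0$. Then, for any $y\in H$, $$\big\|\widehat{D}^*T(z)(y)\big\|_H^2=\langle y,e_1\rangle^2+\langle y,e_2\rangle^2+12\left(\langle y,e_1\rangle\frac{z_1z_2}{z_1^2+z_2^2}-\langle y,e_2\rangle\frac{z_1^2-z_2^2}{2(z_1^2+z_2^2)}\right)^2.$$ (vi) $T$ maps every bounded subset of $H$ to a relatively compact subset of $H$. (vii) The covering constant for $T$ satisfies $\hat{\alpha}(T,\bar{x},\bar{y})=0$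 for any $\bar{x},\bar{y}\in H$ with $\bar{y}=T\bar{x}$. (viii) For any $z\in H$, $\theta\in\widehat{D}^*T(z)(y)$ for every $y\in H$ with $\langle y,e_1\rangle^2+\langle y,e_2\rangle^2=0$. (ix) Let $z\in H$. If $\langle z,e_1\rangle^2+\langle z,e_2\rangle^2=0$, then $T$ is not Mordukhovich differentiable at $z$; more precisely, $\widehat{D}^*T(z)(y)=\emptyset$ for every $y\in H$ with $\langle y,e_1\rangle^2+\langle y,e_2\rangle^2>0$. (x) Let $z\in H$. If $\langle z,e_1\rangle^2+\langle z,e_2\rangle^2=0$, then $T$ is not Fréchet differentiable at $z$.
   Context: $\langle\cdot,\cdot\rangle$ and $\|\cdot\|_H$ are the inner product and norm of $H$; $\mathbb{B}(x,\eta)$ is the closed ball with center $x$ and radius $\eta$. The orthonormal basis $\{e_i\}$ is indexed by $i=1,2,\ldots$ (up to $\dim H$ if $H$ is finite-dimensional), and sums over $i$ range over these indices. For $x\in H$, $\operatorname{sc}(x)=(\langle x,e_1\rangle,\langle x,e_2\rangle,\ldots)$ is the sequence of coefficients of $x$, regarded as a row vector. A continuous (not necessarily linear) operator $T:H\to H$ is a quasi-Hilbert-Schmidt operator on $H$ if $\sum_i\|Te_i\|_H^2<\infty$; its Hilbert-Schmidt norm (with respect to the given basis) is defined by $\|T\|_{HS}^2=\sum_i\|Te_i\|_H^2$. $\nabla g(\bar{x})$ denotes the Fréchet derivative of $g$ at $\bar{x}$, a continuous linear map $H\to H$; $\nabla g(\bar{x})^*$ is its adjoint. For a continuous single-valued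 $g:H\to H$ and $x,y\in H$, the Mordukhovich derivative (coderivative) of $g$ at $x$ is the set-valued mapping $$\widehat{D}^*g(x)(y)=\left\{v\in H:\ \limsup_{u\to x}\frac{\langle v,u-x\rangle-\langle y,g(u)-g(x)\rangle}{\|u-x\|_H+\|g(u)-g(x)\|_H}\le 0\right\},$$ and $g$ is Mordukhovich differentiable at $x$ if $\widehat{D}^*g(x)(y)\ne\emptyset$ for every $y\in H$. When the value is a singleton it is identified with its element: $\widehat{D}^*g(x)(y)=v$ means $\widehat{D}^*g(x)(y)=\{v\}$. For $\bar{x},\bar{y}\in H$ with $\bar{y}=g(\bar{x})$, the covering constant is $$\hat{\alpha}(g,\bar{x},\bar{y})=\sup_{\eta>0}\inf\{\|v\|_H:\ v\in\widehat{D}^*g(x)(w),\ x\in\mathbb{B}(\bar{x},\eta),\ g(x)\in\mathbb{B}(\bar{y},\eta),\ \|w\|_H=1\}.$$ *)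

theory Defs
  imports "HOL-Analysis.Analysis"
begin

text \<open>
  A real Hilbert space is a type of sort \<open>{real_inner, complete_space}\<close>. Basis vectors are
  numbered from 1, up to the Hilbert dimension \<open>N\<close>, which is \<open>\<infinity>\<close> in the infinite-dimensional case.
\<close>

definition idx :: "enat \<Rightarrow> nat set" where
  "idx N = {i. 1 \<le> i \<and> enat i \<le> N}"

definition orthonormal_basis :: "enat \<Rightarrow> (nat \<Rightarrow> 'a::real_inner) \<Rightarrow> bool" where
  "orthonormal_basis N e \<longleftrightarrow>
     (\<forall>i\<in>idx N. \<forall>j\<in>idx N. e i \<bullet> e j = (if i = j then 1 else 0)) \<and>
     closure (span (e ` idx N)) = UNIV"

definition sc :: "(nat \<Rightarrow> 'a::real_inner) \<Rightarrow> 'a \<Rightarrow> nat \<Rightarrow> real" where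
  "sc e x i = x \<bullet> e i"

text \<open>
  \<open>row_mult N s M\<close> is the row vector \<open>s M\<close>, and \<open>row_basis N e s\<close> is the product of the row
  vector \<open>s\<close> with the column of basis vectors.
\<close>

definition row_mult :: "enat \<Rightarrow> (nat \<Rightarrow> real) \<Rightarrow> (nat \<Rightarrow> nat \<Rightarrow> real) \<Rightarrow> nat \<Rightarrow> real" where
  "row_mult N s M j = (\<Sum>\<^sub>\<infinity>i\<in>idx N. s i * M i j)"

definition row_basis :: "enat \<Rightarrow> (nat \<Rightarrow> 'a::real_inner) \<Rightarrow> (nat \<Rightarrow> real) \<Rightarrow> 'a" where
  "row_basis N e s = (\<Sum>\<^sub>\<infinity>j\<in>idx N. s j *\<^sub>R e j)"

definition mat_transpose :: "(nat \<Rightarrow> nat \<Rightarrow> real) \<Rightarrow> nat \<Rightarrow> nat \<Rightarrow> real" where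
  "mat_transpose M i j = M j i"

definition quasi_hilbert_schmidt ::
    "enat \<Rightarrow> (nat \<Rightarrow> 'a::real_inner) \<Rightarrow> ('a \<Rightarrow> 'a) \<Rightarrow> bool" where
  "quasi_hilbert_schmidt N e T \<longleftrightarrow>
     continuous_on UNIV T \<and> (\<lambda>i. (norm (T (e i)))\<^sup>2) summable_on idx N"

definition hs_norm :: "enat \<Rightarrow> (nat \<Rightarrow> 'a::real_inner) \<Rightarrow> ('a \<Rightarrow> 'a) \<Rightarrow> real" where
  "hs_norm N e T = sqrt (\<Sum>\<^sub>\<infinity>i\<in>idx N. (norm (T (e i)))\<^sup>2)"

definition coderivative :: "('a::real_inner \<Rightarrow> 'a) \<Rightarrow> 'a \<Rightarrow> 'a \<Rightarrow> 'a set" where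
  "coderivative g x y =
     {v. Limsup (at x) (\<lambda>u. ereal ((v \<bullet> (u - x) - y \<bullet> (g u - g x)) /
                                   (norm (u - x) + norm (g u - g x)))) \<le> 0}"

definition mordukhovich_differentiable :: "('a::real_inner \<Rightarrow> 'a) \<Rightarrow> 'a \<Rightarrow> bool" where
  "mordukhovich_differentiable g x \<longleftrightarrow> (\<forall>y. coderivative g x y \<noteq> {})"

text \<open>Extended reals, so that the infimum of the empty set is \<open>\<infinity>\<close>.\<close>

definition covering_constant :: "('a::real_inner \<Rightarrow> 'a) \<Rightarrow> 'a \<Rightarrow> 'a \<Rightarrow> ereal" where
  "covering_constant g xb yb =
     (SUP \<eta>\<in>{0::real<..}. Inf {ereal (norm v) |v x w.
        v \<in> coderivative g x w \<and> x \<in> cball xb \<eta> \<and> g x \<in> cball yb \<eta> \<and> norm w = 1})"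

definition opT :: "(nat \<Rightarrow> 'a::real_inner) \<Rightarrow> 'a \<Rightarrow> 'a" where
  "opT e x =
     (if (x \<bullet> e 1)\<^sup>2 + (x \<bullet> e 2)\<^sup>2 > 0
      then (((x \<bullet> e 1)\<^sup>2 - (x \<bullet> e 2)\<^sup>2) / sqrt ((x \<bullet> e 1)\<^sup>2 + (x \<bullet> e 2)\<^sup>2)) *\<^sub>R e 1
         + ((2 * (x \<bullet> e 1) * (x \<bullet> e 2)) / sqrt ((x \<bullet> e 1)\<^sup>2 + (x \<bullet> e 2)\<^sup>2)) *\<^sub>R e 2
      else 0)"

definition matD :: "(nat \<Rightarrow> 'a::real_inner) \<Rightarrow> 'a \<Rightarrow> nat \<Rightarrow> nat \<Rightarrow> real" where
  "matD e z i j =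
     (let a = z \<bullet> e 1; b = z \<bullet> e 2 in
      1 / ((a\<^sup>2 + b\<^sup>2) * sqrt (a\<^sup>2 + b\<^sup>2)) *
      (if i = 1 \<and> j = 1 then (a\<^sup>2 + 3 * b\<^sup>2) * a
       else if i = 1 \<and> j = 2 then 2 * b\<^sup>2 * b
       else if i = 2 \<and> j = 1 then - (3 * a\<^sup>2 + b\<^sup>2) * b
       else if i = 2 \<and> j = 2 then 2 * a\<^sup>2 * a
       else 0))"

end

theory Submission
  imports Defs
begin

text \<open>
  On the plane spanned by the first two basis vectors, the operator is
  \<open>r (cos \<phi>, sin \<phi>) \<mapsto> r (cos 2\<phi>, sin 2\<phi>)\<close>, composed with the orthogonal projection onto that
  plane. It is smooth away from the axis \<open>r = 0\<close>, and there the coderivative is the adjoint of the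
  derivative. On the axis, the operator is positively homogeneous and even, so a coderivative
  element \<open>v\<close> would satisfy \<open>\<bar>v \<bullet> h\<bar> \<le> y \<bullet> T h\<close> for all \<open>h\<close>, while \<open>T\<close> takes all directions of the
  plane as values. The covering constant vanishes because a third basis vector is orthogonal to the
  range of \<open>T\<close>.
\<close>

section \<open>Coderivatives\<close>

text \<open>The limsup condition bounds the quotient by every positive level near \<open>x\<close>,
  and the denominator, positive for \<open>u \<noteq> x\<close>, can be cleared. The coderivative is
  handled in this form below, free of extended reals and division.\<close>

lemma coderivative_iff_eventually:
  "v \<in> coderivative g x y \<longleftrightarrow>
     (\<forall>\<epsilon>>0. eventually (\<lambda>u. v \<bullet> (u - x) - y \<bullet> (g u - g x)
                            \<le> \<epsilon> * (norm (u - x) + norm (g u - g x))) (at x))"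
proof -
  define Q where "Q u = (v \<bullet> (u - x) - y \<bullet> (g u - g x)) / (norm (u - x) + norm (g u - g x))" for u
  have Q_iff: "Q u \<le> \<epsilon> \<longleftrightarrow> v \<bullet> (u - x) - y \<bullet> (g u - g x) \<le> \<epsilon> * (norm (u - x) + norm (g u - g x))"
    if "u \<noteq> x" for u \<epsilon>
  proof -
    have "norm (u - x) + norm (g u - g x) > 0"
      using that by (intro add_pos_nonneg) auto
    then show ?thesis
      unfolding Q_def by (simp add: pos_divide_le_eq)
  qed
  \<comment> \<open>The filter \<open>at x\<close> leaves out \<open>u = x\<close>, the only point
    where the denominator vanishes.\<close>
  have ev_eq: "eventually (\<lambda>u. Q u \<le> \<epsilon>) (at x) \<longleftrightarrow>
      eventually (\<lambda>u. v \<bullet> (u - x) - y \<bullet> (g u - g x)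
                            \<le> \<epsilon> * (norm (u - x) + norm (g u - g x))) (at x)" for \<epsilon>
    unfolding eventually_at_filter using Q_iff by (intro eventually_subst always_eventually) auto
  have "v \<in> coderivative g x y \<longleftrightarrow> (\<forall>c>0. eventually (\<lambda>u. ereal (Q u) < c) (at x))"
    unfolding coderivative_def Q_def by (simp add: Limsup_le_iff)
  also have "\<dots> \<longleftrightarrow> (\<forall>\<epsilon>>0. eventually (\<lambda>u. Q u \<le> \<epsilon>) (at x))"
  proof safe
    fix \<epsilon> :: real assume "\<epsilon> > 0" "\<forall>c>0. eventually (\<lambda>u. ereal (Q u) < c) (at x)"
    then have "eventually (\<lambda>u. ereal (Q u) < ereal \<epsilon>) (at x)"
      by (metis ereal_less(2))
    then show "eventually (\<lambda>u. Q u \<le> \<epsilon>) (at x)"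
      by eventually_elim simp
  next
    fix c :: ereal assume "c > 0" and Q: "\<forall>\<epsilon>>0. eventually (\<lambda>u. Q u \<le> \<epsilon>) (at x)"
    \<comment> \<open>\<open>c\<close> may be infinite; a real \<open>d\<close> strictly between 0
      and \<open>c\<close> turns the weak bound into the strict one.\<close>
    then obtain d where d: "0 < ereal d" "ereal d < c"
      using ereal_dense2 by blast
    with Q have "eventually (\<lambda>u. Q u \<le> d) (at x)"
      by simp
    then show "eventually (\<lambda>u. ereal (Q u) < c) (at x)"
      by eventually_elim (rule le_less_trans[OF _ d(2)], simp)
  qed
  finally show ?thesis
    unfolding ev_eq .
qed

text \<open>Restrict the inequality to the ray \<open>x + t h\<close>, divide by \<open>t\<close>
  and let \<open>t\<close> tend to 0 from the right. Only a one-sided directional derivative enters,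
  so this also applies where the operator below is not differentiable.\<close>

lemma coderivative_direction:
  assumes v: "v \<in> coderivative g x y"
    and lim: "((\<lambda>t. (g (x + t *\<^sub>R h) - g x) /\<^sub>R t) \<longlongrightarrow> d) (at_right 0)"
  shows "v \<bullet> h \<le> y \<bullet> d"
proof (cases "h = 0")
  \<comment> \<open>For \<open>h = 0\<close> the ray is constant and never enters the punctured
    neighbourhood; the quotients are all 0, so \<open>d = 0\<close>.\<close>
  case True
  then have "((\<lambda>t. 0) \<longlongrightarrow> d) (at_right (0::real))"
    using lim by simp
  then have "d = 0"
    by (simp add: tendsto_const_iff)
  with True show ?thesis by simp
next
  case False
  have line: "filterlim (\<lambda>t. x + t *\<^sub>R h) (at x) (at_right (0::real))"
    unfolding filterlim_at
  proof
    show "eventually (\<lambda>t. x + t *\<^sub>R h \<in> UNIV \<and> x + t *\<^sub>R h \<noteq> x) (at_right (0::real))"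
      using False by (auto simp: eventually_at_filter)
    show "((\<lambda>t. x + t *\<^sub>R h) \<longlongrightarrow> x) (at_right (0::real))"
      by (rule tendsto_eq_intros | simp)+
  qed
  have bound: "v \<bullet> h - y \<bullet> d \<le> \<epsilon> * (norm h + norm d)" if "\<epsilon> > 0" for \<epsilon>
  proof (rule tendsto_le)
    show "((\<lambda>t. v \<bullet> h - y \<bullet> ((g (x + t *\<^sub>R h) - g x) /\<^sub>R t)) \<longlongrightarrow> v \<bullet> h - y \<bullet> d) (at_right 0)"
      by (intro tendsto_intros lim)
    show "((\<lambda>t. \<epsilon> * (norm h + norm ((g (x + t *\<^sub>R h) - g x) /\<^sub>R t))) \<longlongrightarrow>
        \<epsilon> * (norm h + norm d)) (at_right 0)"
      by (intro tendsto_intros lim)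
    have "eventually (\<lambda>u. v \<bullet> (u - x) - y \<bullet> (g u - g x)
                            \<le> \<epsilon> * (norm (u - x) + norm (g u - g x))) (at x)"
      using v that unfolding coderivative_iff_eventually by blast
    then have "eventually (\<lambda>t. v \<bullet> (t *\<^sub>R h) - y \<bullet> (g (x + t *\<^sub>R h) - g x)
        \<le> \<epsilon> * (norm (t *\<^sub>R h) + norm (g (x + t *\<^sub>R h) - g x))) (at_right 0)"
      using eventually_compose_filterlim[OF _ line] by fastforce
    moreover have "eventually (\<lambda>t. t > 0) (at_right (0::real))"
      by (simp add: eventually_at_right_less)
    ultimately show "eventually (\<lambda>t. v \<bullet> h - y \<bullet> ((g (x + t *\<^sub>R h) - g x) /\<^sub>R t)
        \<le> \<epsilon> * (norm h + norm ((g (x + t *\<^sub>R h) - g x) /\<^sub>R t))) (at_right 0)"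
    proof eventually_elim
      case (elim t)
      define k where "k = g (x + t *\<^sub>R h) - g x"
      have "t * (v \<bullet> h) - y \<bullet> k \<le> \<epsilon> * (t * norm h + norm k)"
        using elim by (simp add: k_def)
      then have "(t * (v \<bullet> h) - y \<bullet> k) / t \<le> \<epsilon> * (t * norm h + norm k) / t"
        using elim(2) by (intro divide_right_mono) auto
      moreover have "(t * (v \<bullet> h) - y \<bullet> k) / t = v \<bullet> h - y \<bullet> (k /\<^sub>R t)"
        using elim(2) by (simp add: diff_divide_distrib inverse_eq_divide)
      moreover have "\<epsilon> * (t * norm h + norm k) / t = \<epsilon> * (norm h + norm (k /\<^sub>R t))"
        using elim(2) by (simp add: field_simps)
      ultimately show ?case
        unfolding k_def by simp
    qed
  qed simp
  \<comment> \<open>Since \<open>C\<close> is positive, the choice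
    \<open>\<epsilon> = \<delta> / C\<close> makes the right-hand side an arbitrary positive
    \<open>\<delta>\<close>.\<close>
  define C where "C = norm h + norm d"
  have "C > 0"
    unfolding C_def using False by (simp add: add_pos_nonneg)
  have "v \<bullet> h - y \<bullet> d \<le> \<delta>" if "\<delta> > 0" for \<delta>
    using bound[of "\<delta> / C"] that \<open>C > 0\<close> unfolding C_def[symmetric] by simp
  then have "v \<bullet> h - y \<bullet> d \<le> 0"
    by (metis field_le_epsilon add_0)
  then show ?thesis by simp
qed

text \<open>The chain rule along the line through \<open>x\<close> in direction \<open>h\<close>
  gives a two-sided limit; only its right half is kept, to fit
  \<open>coderivative_direction\<close>.\<close>

lemma has_derivative_imp_right_quotient:
  fixes g :: "'a::real_normed_vector \<Rightarrow> 'b::real_normed_vector"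
  assumes "(g has_derivative g') (at x)"
  shows "((\<lambda>t. (g (x + t *\<^sub>R h) - g x) /\<^sub>R t) \<longlongrightarrow> g' h) (at_right 0)"
proof -
  have lin: "linear g'"
    using assms has_derivative_linear by blast
  have "((\<lambda>t. x + t *\<^sub>R h) has_vector_derivative h) (at (0::real))"
    by (auto intro!: derivative_eq_intros simp: has_vector_derivative_def)
  moreover have "(g has_derivative g') (at (x + 0 *\<^sub>R h))"
    using assms by simp
  ultimately have "((\<lambda>t. g (x + t *\<^sub>R h)) has_derivative (\<lambda>t. g' (t *\<^sub>R h))) (at (0::real))"
    unfolding has_vector_derivative_def by (rule has_derivative_compose)
  then have "((\<lambda>t. g (x + t *\<^sub>R h)) has_vector_derivative g' h) (at 0)"
    unfolding has_vector_derivative_def by (simp add: linear_scale[OF lin])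
  then have "((\<lambda>t. norm (g (x + t *\<^sub>R h) - g x - t *\<^sub>R g' h) / norm t) \<longlongrightarrow> 0) (at (0::real))"
    unfolding has_vector_derivative_def has_derivative_at by simp
  moreover have "eventually (\<lambda>t. norm (g (x + t *\<^sub>R h) - g x - t *\<^sub>R g' h) / norm t
      = norm ((g (x + t *\<^sub>R h) - g x) /\<^sub>R t - g' h)) (at (0::real))"
  proof -
    have "norm (k - t *\<^sub>R d) / norm t = norm (k /\<^sub>R t - d)" if "t \<noteq> 0" for t :: real and k d :: 'b
    proof -
      have "k /\<^sub>R t - d = (k - t *\<^sub>R d) /\<^sub>R t"
        using that by (simp add: scaleR_diff_right)
      then show ?thesis
        by (simp add: divide_inverse_commute)
    qed
    then show ?thesis
      by (simp add: eventually_at_filter)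
  qed
  ultimately have "((\<lambda>t. norm ((g (x + t *\<^sub>R h) - g x) /\<^sub>R t - g' h)) \<longlongrightarrow> 0) (at 0)"
    by (rule Lim_transform_eventually)
  then have "((\<lambda>t. (g (x + t *\<^sub>R h) - g x) /\<^sub>R t) \<longlongrightarrow> g' h) (at 0)"
    by (rule LIM_zero_cancel[OF tendsto_norm_zero_cancel])
  then show ?thesis
    by (rule tendsto_within_subset) simp
qed

text \<open>Uniqueness: the test direction \<open>v - w\<close> forces its own squared norm to be at
  most 0. Membership: the first-order remainder paired with \<open>y\<close> is small compared with
  \<open>norm (u - x)\<close>. The vector \<open>w\<close> stands for the adjoint derivative applied
  to \<open>y\<close>.\<close>

lemma coderivative_has_derivative:
  assumes der: "(g has_derivative g') (at x)"
    and adj: "\<And>h. y \<bullet> g' h = w \<bullet> h"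
  shows "coderivative g x y = {w}"
proof (intro equalityI subsetI)
  fix v assume v: "v \<in> coderivative g x y"
  have "v \<bullet> (v - w) \<le> y \<bullet> g' (v - w)"
    using coderivative_direction[OF v has_derivative_imp_right_quotient[OF der]] .
  then have "(v - w) \<bullet> (v - w) \<le> 0"
    unfolding adj by (simp add: inner_diff_left)
  then show "v \<in> {w}"
    by (metis antisym inner_eq_zero_iff inner_ge_zero right_minus_eq singletonI)
next
  fix v assume "v \<in> {w}"
  moreover have "eventually (\<lambda>u. w \<bullet> (u - x) - y \<bullet> (g u - g x)
      \<le> \<epsilon> * (norm (u - x) + norm (g u - g x))) (at x)" if "\<epsilon> > 0" for \<epsilon>
  proof -
    \<comment> \<open>The denominator absorbs the Cauchy-Schwarz factor \<open>norm y\<close>; the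
      added 1 keeps it positive when \<open>y = 0\<close>.\<close>
    define \<delta> where "\<delta> = \<epsilon> / (norm y + 1)"
    have ny: "norm y + 1 > 0"
      by (simp add: add_nonneg_pos)
    have "\<delta> > 0"
      unfolding \<delta>_def using that ny by simp
    then obtain d where "d > 0" and
      d: "\<And>u. norm (u - x) < d \<Longrightarrow> norm (g u - g x - g' (u - x)) \<le> \<delta> * norm (u - x)"
      using der unfolding has_derivative_at_alt by blast
    have "w \<bullet> (u - x) - y \<bullet> (g u - g x) \<le> \<epsilon> * (norm (u - x) + norm (g u - g x))"
      if "dist u x < d" for u
    proof -
      have "w \<bullet> (u - x) - y \<bullet> (g u - g x) = - (y \<bullet> (g u - g x - g' (u - x)))"
        unfolding adj[symmetric] by (simp add: inner_diff_right)
      also have "\<dots> \<le> norm y * norm (g u - g x - g' (u - x))"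
        using Cauchy_Schwarz_ineq2[of y "g u - g x - g' (u - x)"] by linarith
      also have "\<dots> \<le> (norm y + 1) * (\<delta> * norm (u - x))"
        using d[of u] that by (intro mult_mono) (auto simp: dist_norm)
      also have "\<dots> = \<epsilon> * norm (u - x)"
        unfolding \<delta>_def using ny by simp
      also have "\<dots> \<le> \<epsilon> * (norm (u - x) + norm (g u - g x))"
        using \<open>\<epsilon> > 0\<close> by (intro mult_left_mono) auto
      finally show ?thesis .
    qed
    then show ?thesis
      unfolding eventually_at using \<open>d > 0\<close> by blast
  qed
  ultimately show "v \<in> coderivative g x y"
    unfolding coderivative_iff_eventually by blast
qed

text \<open>For \<open>v = 0\<close> and \<open>y\<close> orthogonal to the range, the numerator of
  the quotient vanishes identically.\<close>

lemma zero_in_coderivative_orthogonal_range: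
  assumes "\<And>u. y \<bullet> g u = 0"
  shows "0 \<in> coderivative g x y"
  unfolding coderivative_iff_eventually by (simp add: inner_diff_right assms)

section \<open>The angle-doubling operator\<close>

text \<open>The case distinction in the definition is redundant because division by zero yields zero.\<close>

lemma opT_eq:
  "opT e x = (((x \<bullet> e 1)\<^sup>2 - (x \<bullet> e 2)\<^sup>2) / sqrt ((x \<bullet> e 1)\<^sup>2 + (x \<bullet> e 2)\<^sup>2)) *\<^sub>R e 1
           + ((2 * (x \<bullet> e 1) * (x \<bullet> e 2)) / sqrt ((x \<bullet> e 1)\<^sup>2 + (x \<bullet> e 2)\<^sup>2)) *\<^sub>R e 2"
  by (auto simp: opT_def sum_power2_gt_zero_iff)

text \<open>The numerators are homogeneous of degree 2 and the root of degree 1. The sign of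
  \<open>t\<close> matters: the operator is even, so a negative factor would come out as its
  absolute value.\<close>

lemma opT_scaleR:
  assumes "t > 0"
  shows "opT e (t *\<^sub>R x) = t *\<^sub>R opT e x"
proof -
  have "sqrt ((t * (x \<bullet> e 1))\<^sup>2 + (t * (x \<bullet> e 2))\<^sup>2) = t * sqrt ((x \<bullet> e 1)\<^sup>2 + (x \<bullet> e 2)\<^sup>2)"
    using assms by (simp add: power_mult_distrib real_sqrt_mult flip: distrib_left)
  moreover have "((t * p)\<^sup>2 - (t * q)\<^sup>2) / (t * r) = t * ((p\<^sup>2 - q\<^sup>2) / r)"
    "2 * (t * p) * (t * q) / (t * r) = t * (2 * p * q / r)" for p q r
  proof -
    have "(t * p)\<^sup>2 - (t * q)\<^sup>2 = t * (t * (p\<^sup>2 - q\<^sup>2))"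
      by algebra
    then show "((t * p)\<^sup>2 - (t * q)\<^sup>2) / (t * r) = t * ((p\<^sup>2 - q\<^sup>2) / r)"
      "2 * (t * p) * (t * q) / (t * r) = t * (2 * p * q / r)"
      using assms by simp_all
  qed
  ultimately show ?thesis
    unfolding opT_eq by (simp add: scaleR_right_distrib)
qed

lemma opT_add_axis:
  assumes "z \<bullet> e 1 = 0" "z \<bullet> e 2 = 0"
  shows "opT e (z + x) = opT e x"
  unfolding opT_eq using assms by (simp add: inner_add_left)

text \<open>Invariance under translation by \<open>z\<close> and positive homogeneity make the
  quotient equal to \<open>opT e h\<close> for every \<open>t > 0\<close>. On the axis the operator
  is thus its own one-sided directional derivative.\<close>

lemma opT_quotient_axis:
  assumes "z \<bullet> e 1 = 0" "z \<bullet> e 2 = 0"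
  shows "((\<lambda>t. (opT e (z + t *\<^sub>R h) - opT e z) /\<^sub>R t) \<longlongrightarrow> opT e h) (at_right 0)"
proof (rule tendsto_eventually)
  have "opT e z = 0"
    using assms by (simp add: opT_def)
  have "eventually (\<lambda>t. t > 0) (at_right (0::real))"
    by (simp add: eventually_at_right_less)
  then show "eventually (\<lambda>t. (opT e (z + t *\<^sub>R h) - opT e z) /\<^sub>R t = opT e h) (at_right 0)"
    by eventually_elim (simp add: opT_add_axis[OF assms] opT_scaleR \<open>opT e z = 0\<close>)
qed

section \<open>The derivative away from the axis and its adjoint\<close>

definition opT_deriv :: "(nat \<Rightarrow> 'a::real_inner) \<Rightarrow> 'a \<Rightarrow> 'a \<Rightarrow> 'a" where
  "opT_deriv e z x =
     ((x \<bullet> e 1) * matD e z 1 1 + (x \<bullet> e 2) * matD e z 2 1) *\<^sub>R e 1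
   + ((x \<bullet> e 1) * matD e z 1 2 + (x \<bullet> e 2) * matD e z 2 2) *\<^sub>R e 2"

text \<open>Like \<open>opT_deriv\<close>, a two-term form of a product of a row vector with the
  matrix, here the transposed one. This keeps index sets and infinite sums out of the calculus; the
  matrix forms are recovered through \<open>row_basis_row_mult_support\<close>.\<close>

definition opT_coderiv :: "(nat \<Rightarrow> 'a::real_inner) \<Rightarrow> 'a \<Rightarrow> 'a \<Rightarrow> 'a" where
  "opT_coderiv e z y =
     ((y \<bullet> e 1) * matD e z 1 1 + (y \<bullet> e 2) * matD e z 1 2) *\<^sub>R e 1
   + ((y \<bullet> e 1) * matD e z 2 1 + (y \<bullet> e 2) * matD e z 2 2) *\<^sub>R e 2"

text \<open>Both sides are the bilinear form with matrix \<open>matD e z\<close>, evaluated at the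
  first two coordinates of \<open>x\<close> and \<open>y\<close>.\<close>

lemma opT_deriv_adjoint: "y \<bullet> opT_deriv e z x = opT_coderiv e z y \<bullet> x"
  unfolding opT_deriv_def opT_coderiv_def
  by (simp add: inner_add_right inner_add_left inner_commute algebra_simps)

text \<open>The quotient rule is applied to the two coefficient functions, whose common denominator
  is the radius, smooth where it is positive. What remains is to recognise the entries of
  \<open>matD\<close>.\<close>

lemma opT_has_derivative:
  assumes "(z \<bullet> e 1)\<^sup>2 + (z \<bullet> e 2)\<^sup>2 > 0"
  shows "(opT e has_derivative opT_deriv e z) (at z)"
proof -
  define a b where "a = z \<bullet> e 1" and "b = z \<bullet> e 2"
  define r where "r = sqrt (a\<^sup>2 + b\<^sup>2)"
  have pos: "a\<^sup>2 + b\<^sup>2 > 0"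
    using assms by (simp add: a_def b_def)
  then have r: "r > 0" "r\<^sup>2 = a\<^sup>2 + b\<^sup>2"
    by (simp_all add: r_def)
  have der_s: "((\<lambda>x. (x \<bullet> e 1)\<^sup>2 + (x \<bullet> e 2)\<^sup>2) has_derivative
      (\<lambda>h. 2 * (a * (h \<bullet> e 1) + b * (h \<bullet> e 2)))) (at z)"
    by (auto intro!: derivative_eq_intros simp: a_def b_def algebra_simps)
  have der_sqrt: "DERIV sqrt ((z \<bullet> e 1)\<^sup>2 + (z \<bullet> e 2)\<^sup>2) :> 1 / (2 * r)"
    using DERIV_real_sqrt[OF assms] by (simp add: r_def a_def b_def inverse_eq_divide mult.commute)
  have "((\<lambda>x. sqrt ((x \<bullet> e 1)\<^sup>2 + (x \<bullet> e 2)\<^sup>2)) has_derivative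
      (\<lambda>h. 2 * (a * (h \<bullet> e 1) + b * (h \<bullet> e 2)) * (1 / (2 * r)))) (at z)"
    by (rule DERIV_compose_FDERIV[where f = sqrt and g = "\<lambda>x. (x \<bullet> e 1)\<^sup>2 + (x \<bullet> e 2)\<^sup>2",
          OF der_sqrt der_s])
  then have der_r: "((\<lambda>x. sqrt ((x \<bullet> e 1)\<^sup>2 + (x \<bullet> e 2)\<^sup>2)) has_derivative
      (\<lambda>h. (a * (h \<bullet> e 1) + b * (h \<bullet> e 2)) / r)) (at z)"
    by (rule has_derivative_eq_rhs) (simp add: fun_eq_iff add_divide_distrib)
  have r0: "sqrt ((z \<bullet> e 1)\<^sup>2 + (z \<bullet> e 2)\<^sup>2) \<noteq> 0"
    using r(1) unfolding r_def a_def b_def by linarith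
  have der1: "((\<lambda>x. ((x \<bullet> e 1)\<^sup>2 - (x \<bullet> e 2)\<^sup>2) / sqrt ((x \<bullet> e 1)\<^sup>2 + (x \<bullet> e 2)\<^sup>2)) has_derivative
      (\<lambda>h. ((2 * a * (h \<bullet> e 1) - 2 * b * (h \<bullet> e 2)) * r
             - (a\<^sup>2 - b\<^sup>2) * ((a * (h \<bullet> e 1) + b * (h \<bullet> e 2)) / r)) / (r * r))) (at z)"
    by (rule has_derivative_eq_rhs[OF has_derivative_divide'[OF _ der_r r0]])
       (auto intro!: derivative_eq_intros simp: a_def b_def r_def)
  have der2: "((\<lambda>x. 2 * (x \<bullet> e 1) * (x \<bullet> e 2) / sqrt ((x \<bullet> e 1)\<^sup>2 + (x \<bullet> e 2)\<^sup>2)) has_derivative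
      (\<lambda>h. ((2 * b * (h \<bullet> e 1) + 2 * a * (h \<bullet> e 2)) * r
             - 2 * a * b * ((a * (h \<bullet> e 1) + b * (h \<bullet> e 2)) / r)) / (r * r))) (at z)"
    by (rule has_derivative_eq_rhs[OF has_derivative_divide'[OF _ der_r r0]])
       (auto intro!: derivative_eq_intros simp: a_def b_def r_def algebra_simps)
  have rr: "r * r = a\<^sup>2 + b\<^sup>2"
    using r(2) by (simp add: power2_eq_square)
  \<comment> \<open>Both quotient-rule results have this shape: \<open>p\<close> is the derivative
    of the numerator and \<open>q\<close> is its value times \<open>a h + b k\<close>. Expanding by
    \<open>r\<close> produces the denominator of \<open>matD\<close>.\<close>
  have quot: "(p * r - q / r) / (r * r) = (p * (a\<^sup>2 + b\<^sup>2) - q) / ((a\<^sup>2 + b\<^sup>2) * r)" for p q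
  proof -
    have "p * r - q / r = (p * (r * r) - q) / r"
      using r(1) by (simp add: field_simps)
    then show ?thesis
      unfolding rr by (simp add: mult.commute)
  qed
  have M: "matD e z 1 1 = (a\<^sup>2 + 3 * b\<^sup>2) * a / ((a\<^sup>2 + b\<^sup>2) * r)"
    "matD e z 1 2 = 2 * b\<^sup>2 * b / ((a\<^sup>2 + b\<^sup>2) * r)"
    "matD e z 2 1 = - (3 * a\<^sup>2 + b\<^sup>2) * b / ((a\<^sup>2 + b\<^sup>2) * r)"
    "matD e z 2 2 = 2 * a\<^sup>2 * a / ((a\<^sup>2 + b\<^sup>2) * r)"
    unfolding matD_def Let_def a_def[symmetric] b_def[symmetric] r_def[symmetric] by simp_all
  have c1: "((2 * a * h - 2 * b * k) * r - (a\<^sup>2 - b\<^sup>2) * ((a * h + b * k) / r)) / (r * r)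
      = h * matD e z 1 1 + k * matD e z 2 1" for h k
  proof -
    have "((2 * a * h - 2 * b * k) * r - (a\<^sup>2 - b\<^sup>2) * (a * h + b * k) / r) / (r * r)
      = ((2 * a * h - 2 * b * k) * (a\<^sup>2 + b\<^sup>2) - (a\<^sup>2 - b\<^sup>2) * (a * h + b * k)) / ((a\<^sup>2 + b\<^sup>2) * r)"
      by (rule quot)
    also have "(2 * a * h - 2 * b * k) * (a\<^sup>2 + b\<^sup>2) - (a\<^sup>2 - b\<^sup>2) * (a * h + b * k)
      = h * ((a\<^sup>2 + 3 * b\<^sup>2) * a) + k * (- (3 * a\<^sup>2 + b\<^sup>2) * b)"
      by algebra
    finally show ?thesis
      unfolding M times_divide_eq_right add_divide_distrib[of "h * ((a\<^sup>2 + 3 * b\<^sup>2) * a)"] .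
  qed
  have c2: "((2 * b * h + 2 * a * k) * r - 2 * a * b * ((a * h + b * k) / r)) / (r * r)
      = h * matD e z 1 2 + k * matD e z 2 2" for h k
  proof -
    have "((2 * b * h + 2 * a * k) * r - 2 * a * b * (a * h + b * k) / r) / (r * r)
      = ((2 * b * h + 2 * a * k) * (a\<^sup>2 + b\<^sup>2) - 2 * a * b * (a * h + b * k)) / ((a\<^sup>2 + b\<^sup>2) * r)"
      by (rule quot)
    also have "(2 * b * h + 2 * a * k) * (a\<^sup>2 + b\<^sup>2) - 2 * a * b * (a * h + b * k)
      = h * (2 * b\<^sup>2 * b) + k * (2 * a\<^sup>2 * a)"
      by algebra
    finally show ?thesis
      unfolding M times_divide_eq_right add_divide_distrib[of "h * (2 * b\<^sup>2 * b)"] .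
  qed
  show ?thesis
    unfolding opT_eq[abs_def] opT_deriv_def[abs_def]
    using has_derivative_add[OF has_derivative_scaleR_left[OF der1, of "e 1"]
        has_derivative_scaleR_left[OF der2, of "e 2"]]
    unfolding c1 c2 .
qed

lemma coderivative_opT:
  assumes "(z \<bullet> e 1)\<^sup>2 + (z \<bullet> e 2)\<^sup>2 > 0"
  shows "coderivative (opT e) z y = {opT_coderiv e z y}"
  using opT_has_derivative[OF assms] opT_deriv_adjoint by (rule coderivative_has_derivative)

text \<open>The entries vanish outside the upper-left block, so both infinite sums collapse to sums
  over \<open>{1, 2}\<close> and no convergence question arises.\<close>

lemma row_basis_row_mult_support:
  assumes "{1, 2} \<subseteq> idx N" and "\<And>i j. i \<notin> {1, 2} \<or> j \<notin> {1, 2} \<Longrightarrow> M i j = 0"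
  shows "row_basis N e (row_mult N s M)
       = (s 1 * M 1 1 + s 2 * M 2 1) *\<^sub>R e 1 + (s 1 * M 1 2 + s 2 * M 2 2) *\<^sub>R e 2"
proof -
  have row: "row_mult N s M j = s 1 * M 1 j + s 2 * M 2 j" for j
  proof -
    have "row_mult N s M j = (\<Sum>\<^sub>\<infinity>i\<in>{1, 2}. s i * M i j)"
      unfolding row_mult_def using assms by (intro infsum_cong_neutral) auto
    then show ?thesis by simp
  qed
  have "row_basis N e (row_mult N s M) = (\<Sum>\<^sub>\<infinity>j\<in>{1, 2}. row_mult N s M j *\<^sub>R e j)"
    unfolding row_basis_def using assms by (intro infsum_cong_neutral) (auto simp: row)
  then show ?thesis by (simp add: row)
qed

lemma matD_support: "i \<notin> {1, 2} \<or> j \<notin> {1, 2} \<Longrightarrow> matD e z i j = 0"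
  unfolding matD_def Let_def by auto

section \<open>Properties resting on the orthonormality of the first two basis vectors\<close>

context
  fixes e :: "nat \<Rightarrow> 'a::real_inner"
  assumes orth: "e 1 \<bullet> e 1 = 1" "e 2 \<bullet> e 2 = 1" "e 1 \<bullet> e 2 = 0"
begin

lemma norm_plane: "(norm (p *\<^sub>R e 1 + q *\<^sub>R e 2))\<^sup>2 = p\<^sup>2 + q\<^sup>2"
  using orth by (simp add: power2_norm_eq_inner inner_add_left inner_add_right inner_commute
      power2_eq_square[of p] power2_eq_square[of q])

text \<open>Angle doubling preserves the radius, by
  \<open>(a^2 - b^2)^2 + (2ab)^2 = (a^2 + b^2)^2\<close>.\<close>

lemma norm_opT: "norm (opT e x) = sqrt ((x \<bullet> e 1)\<^sup>2 + (x \<bullet> e 2)\<^sup>2)"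
proof (cases "(x \<bullet> e 1)\<^sup>2 + (x \<bullet> e 2)\<^sup>2 > 0")
  case True
  define a b where "a = x \<bullet> e 1" and "b = x \<bullet> e 2"
  have pos: "a\<^sup>2 + b\<^sup>2 > 0"
    using True by (simp add: a_def b_def)
  have "(norm (opT e x))\<^sup>2
      = ((a\<^sup>2 - b\<^sup>2) / sqrt (a\<^sup>2 + b\<^sup>2))\<^sup>2 + (2 * a * b / sqrt (a\<^sup>2 + b\<^sup>2))\<^sup>2"
    unfolding opT_eq norm_plane a_def b_def ..
  also have "\<dots> = ((a\<^sup>2 - b\<^sup>2)\<^sup>2 + (2 * a * b)\<^sup>2) / (a\<^sup>2 + b\<^sup>2)"
    using pos by (simp add: power_divide add_divide_distrib)
  also have "(a\<^sup>2 - b\<^sup>2)\<^sup>2 + (2 * a * b)\<^sup>2 = (a\<^sup>2 + b\<^sup>2) * (a\<^sup>2 + b\<^sup>2)"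
    by algebra
  also have "\<dots> / (a\<^sup>2 + b\<^sup>2) = a\<^sup>2 + b\<^sup>2"
    using pos by simp
  finally show ?thesis
    unfolding a_def b_def using norm_ge_zero real_sqrt_unique by metis
next
  case False
  then show ?thesis
    using sum_power2_gt_zero_iff[of "x \<bullet> e 1" "x \<bullet> e 2"] by (simp add: opT_def)
qed

text \<open>The component of \<open>x\<close> orthogonal to the plane has nonnegative squared
  length.\<close>

lemma bessel_plane: "sqrt ((x \<bullet> e 1)\<^sup>2 + (x \<bullet> e 2)\<^sup>2) \<le> norm x"
proof (rule real_le_lsqrt)
  define y where "y = x - (x \<bullet> e 1) *\<^sub>R e 1 - (x \<bullet> e 2) *\<^sub>R e 2"
  have "0 \<le> y \<bullet> y" by simp
  also have "y \<bullet> y = x \<bullet> x - (x \<bullet> e 1)\<^sup>2 - (x \<bullet> e 2)\<^sup>2"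
    unfolding y_def using orth
    by (simp add: inner_diff_left inner_diff_right inner_commute power2_eq_square algebra_simps)
  finally show "(x \<bullet> e 1)\<^sup>2 + (x \<bullet> e 2)\<^sup>2 \<le> (norm x)\<^sup>2"
    by (simp add: power2_norm_eq_inner)
qed simp

text \<open>Modulo a full turn, the angles 0 and pi double to 0, and the angles pi/2 and 3pi/2 to
  pi.\<close>

lemma opT_basis:
  "opT e (e 1) = e 1" "opT e (- e 1) = e 1"
  "opT e (e 2) = - e 1" "opT e (- e 2) = - e 1"
  using orth by (simp_all add: opT_eq inner_commute)

text \<open>At radius \<open>sqrt 2\<close>, the angles pi/4 and 5pi/4 double to pi/2, and the
  angles -pi/4 and 3pi/4 to -pi/2. With \<open>opT_basis\<close>, both orientations of each
  coordinate line are attained as values, each at a pair of opposite points.\<close>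

lemma opT_diagonal:
  "opT e (e 1 + e 2) = sqrt 2 *\<^sub>R e 2" "opT e (- (e 1 + e 2)) = sqrt 2 *\<^sub>R e 2"
  "opT e (e 1 - e 2) = - (sqrt 2 *\<^sub>R e 2)" "opT e (- (e 1 - e 2)) = - (sqrt 2 *\<^sub>R e 2)"
proof -
  have "e 2 \<bullet> e 1 = 0"
    using orth by (simp add: inner_commute)
  with orth show "opT e (e 1 + e 2) = sqrt 2 *\<^sub>R e 2" "opT e (- (e 1 + e 2)) = sqrt 2 *\<^sub>R e 2"
    "opT e (e 1 - e 2) = - (sqrt 2 *\<^sub>R e 2)" "opT e (- (e 1 - e 2)) = - (sqrt 2 *\<^sub>R e 2)"
    by (simp_all add: opT_eq inner_add_left inner_diff_left real_div_sqrt)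
qed

text \<open>A linear map is odd, but this operator takes the same nonzero value at
  \<open>e 1\<close> and \<open>- e 1\<close>.\<close>

lemma not_linear_opT: "\<not> linear (opT e)"
proof
  assume "linear (opT e)"
  then have "opT e (- e 1) = - opT e (e 1)"
    by (rule linear_neg)
  then have "e 1 \<bullet> e 1 = - (e 1 \<bullet> e 1)"
    unfolding opT_basis by (metis inner_minus_left)
  then show False
    using orth by simp
qed

text \<open>Off the axis differentiability gives continuity; near an axis point the norm of the
  value equals the radius, which tends to 0.\<close>

lemma continuous_on_opT: "continuous_on UNIV (opT e)"
  unfolding continuous_on_eq_continuous_at[OF open_UNIV]
proof
  fix z :: 'a
  show "isCont (opT e) z"
  proof (cases "(z \<bullet> e 1)\<^sup>2 + (z \<bullet> e 2)\<^sup>2 > 0")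
    case True
    then show ?thesis
      using opT_has_derivative has_derivative_continuous by blast
  next
    case False
    then have z: "opT e z = 0" "z \<bullet> e 1 = 0" "z \<bullet> e 2 = 0"
      using sum_power2_gt_zero_iff[of "z \<bullet> e 1" "z \<bullet> e 2"] by (simp_all add: opT_def)
    have "((\<lambda>u. norm (opT e u)) \<longlongrightarrow> sqrt ((z \<bullet> e 1)\<^sup>2 + (z \<bullet> e 2)\<^sup>2)) (at z)"
      unfolding norm_opT by (intro tendsto_intros)
    then have "((\<lambda>u. norm (opT e u)) \<longlongrightarrow> 0) (at z)"
      using z by simp
    then show ?thesis
      unfolding isCont_def z by (rule tendsto_norm_zero_cancel)
  qed
qed

text \<open>The range lies in a plane, and the norm bound confines the image to a compact square
  \<open>K\<close> in it.\<close>

lemma compact_closure_opT_image: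
  assumes "bounded B"
  shows "compact (closure (opT e ` B))"
proof -
  obtain M where M: "\<And>x. x \<in> B \<Longrightarrow> norm x \<le> M"
    using assms unfolding bounded_iff by blast
  define K where "K = (\<lambda>(p, q). p *\<^sub>R e 1 + q *\<^sub>R e 2) ` ({-M..M} \<times> {-M..M})"
  have "compact K"
    unfolding K_def case_prod_unfold
    by (intro compact_continuous_image compact_Times compact_Icc continuous_intros)
  moreover have "opT e ` B \<subseteq> K"
  proof
    fix w assume "w \<in> opT e ` B"
    then obtain x where x: "x \<in> B" "w = opT e x" by blast
    then obtain p q where w: "w = p *\<^sub>R e 1 + q *\<^sub>R e 2"
      using opT_eq by metis
    have "norm w \<le> M"
      using M[OF x(1)] bessel_plane[of x] unfolding x(2) norm_opT by linarith
    then have "p\<^sup>2 + q\<^sup>2 \<le> M\<^sup>2"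
      unfolding norm_plane[symmetric] w[symmetric] by (intro power_mono) auto
    then have "p\<^sup>2 \<le> M\<^sup>2" "q\<^sup>2 \<le> M\<^sup>2"
      using zero_le_power2[of p] zero_le_power2[of q] by linarith+
    \<comment> \<open>This uses the point \<open>x\<close> of \<open>B\<close>; for empty
      \<open>B\<close> the bound \<open>M\<close> could be negative.\<close>
    moreover have "M \<ge> 0"
      using \<open>norm w \<le> M\<close> norm_ge_zero order_trans by blast
    ultimately have "\<bar>p\<bar> \<le> M" "\<bar>q\<bar> \<le> M"
      using abs_le_square_iff[of p M] abs_le_square_iff[of q M] by auto
    then show "w \<in> K"
      unfolding K_def w by (auto intro!: image_eqI[where x = "(p, q)"])
  qed
  ultimately have "closure (opT e ` B) \<subseteq> K"
    by (intro closure_minimal compact_imp_closed)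
  then show ?thesis
    using compact_Int_closed[OF \<open>compact K\<close> closed_closure, of "opT e ` B"] by (simp add: Int_absorb1)
qed

text \<open>The adjoint derivative preserves the length of the component of \<open>y\<close> along
  \<open>opT e z\<close> and doubles that of the perpendicular component in the plane. The bracket
  is, up to sign, half the perpendicular component, so the factor 12 is
  \<open>4 * (2^2 - 1)\<close>.\<close>

lemma norm_opT_coderiv:
  assumes "(z \<bullet> e 1)\<^sup>2 + (z \<bullet> e 2)\<^sup>2 > 0"
  defines "a \<equiv> z \<bullet> e 1" and "b \<equiv> z \<bullet> e 2"
  shows "(norm (opT_coderiv e z y))\<^sup>2 = (y \<bullet> e 1)\<^sup>2 + (y \<bullet> e 2)\<^sup>2
    + 12 * ((y \<bullet> e 1) * (a * b / (a\<^sup>2 + b\<^sup>2)) - (y \<bullet> e 2) * ((a\<^sup>2 - b\<^sup>2) / (2 * (a\<^sup>2 + b\<^sup>2))))\<^sup>2"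
proof -
  define h k s where "h = y \<bullet> e 1" and "k = y \<bullet> e 2" and "s = a\<^sup>2 + b\<^sup>2"
  have s: "s > 0"
    using assms by (simp add: s_def)
  define P Q where "P = h * ((a\<^sup>2 + 3 * b\<^sup>2) * a) + k * (2 * b\<^sup>2 * b)"
    and "Q = h * (- (3 * a\<^sup>2 + b\<^sup>2) * b) + k * (2 * a\<^sup>2 * a)"
  have "opT_coderiv e z y = (P / (s * sqrt s)) *\<^sub>R e 1 + (Q / (s * sqrt s)) *\<^sub>R e 2"
    unfolding opT_coderiv_def matD_def Let_def a_def[symmetric] b_def[symmetric] s_def[symmetric]
      P_def Q_def h_def k_def by (simp add: add_divide_distrib)
  then have "(norm (opT_coderiv e z y))\<^sup>2 = (P / (s * sqrt s))\<^sup>2 + (Q / (s * sqrt s))\<^sup>2"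
    by (simp only: norm_plane)
  also have "\<dots> = (P\<^sup>2 + Q\<^sup>2) / (s\<^sup>2 * s)"
    using s by (simp add: power_divide power_mult_distrib add_divide_distrib)
  \<comment> \<open>The factorisation isolates the perpendicular square and leaves one
    \<open>s\<close> to cancel against the denominator.\<close>
  also have "P\<^sup>2 + Q\<^sup>2 = s * ((h\<^sup>2 + k\<^sup>2) * s\<^sup>2 + 3 * (2 * h * a * b - k * (a\<^sup>2 - b\<^sup>2))\<^sup>2)"
    unfolding P_def Q_def s_def by algebra
  also have "\<dots> / (s\<^sup>2 * s) = h\<^sup>2 + k\<^sup>2 + 3 * (2 * h * a * b - k * (a\<^sup>2 - b\<^sup>2))\<^sup>2 / s\<^sup>2"
  proof -
    have "s * (p * s\<^sup>2 + q) / (s\<^sup>2 * s) = p + q / s\<^sup>2" for p q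
      using s by (simp add: field_simps)
    then show ?thesis .
  qed
  also have "3 * (2 * h * a * b - k * (a\<^sup>2 - b\<^sup>2))\<^sup>2 / s\<^sup>2
      = 12 * ((2 * h * a * b - k * (a\<^sup>2 - b\<^sup>2)) / (2 * s))\<^sup>2"
    by (simp add: power_divide power_mult_distrib)
  also have "(2 * h * a * b - k * (a\<^sup>2 - b\<^sup>2)) / (2 * s)
      = h * (a * b / s) - k * ((a\<^sup>2 - b\<^sup>2) / (2 * s))"
    by (simp add: diff_divide_distrib right_diff_distrib)
  finally show ?thesis
    unfolding h_def k_def s_def .
qed

text \<open>Since the operator is even, the bounds for \<open>h\<close> and \<open>- h\<close> add
  up to \<open>y \<bullet> opT e h \<ge> 0\<close>. Positive multiples of \<open>e 1\<close>,
  \<open>- e 1\<close>, \<open>e 2\<close> and \<open>- e 2\<close> all occur as values, so both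
  plane coordinates of \<open>y\<close> would vanish.\<close>

lemma coderivative_opT_axis_empty:
  assumes z: "z \<bullet> e 1 = 0" "z \<bullet> e 2 = 0"
    and y: "(y \<bullet> e 1)\<^sup>2 + (y \<bullet> e 2)\<^sup>2 > 0"
  shows "coderivative (opT e) z y = {}"
proof (rule ccontr)
  assume "coderivative (opT e) z y \<noteq> {}"
  then obtain v where v: "v \<in> coderivative (opT e) z y" by blast
  have dir: "v \<bullet> h \<le> y \<bullet> opT e h" for h
    using coderivative_direction[OF v opT_quotient_axis[OF z]] .
  have "y \<bullet> e 1 = 0"
    using dir[of "e 1"] dir[of "- e 1"] dir[of "e 2"] dir[of "- e 2"]
    unfolding opT_basis inner_minus_right by linarith
  moreover have "y \<bullet> (sqrt 2 *\<^sub>R e 2) = 0"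
    using dir[of "e 1 + e 2"] dir[of "- (e 1 + e 2)"] dir[of "e 1 - e 2"] dir[of "- (e 1 - e 2)"]
    unfolding opT_diagonal inner_minus_right by linarith
  ultimately show False
    using y by simp
qed

text \<open>A derivative would have to agree with the one-sided directional derivative, which is the
  operator itself, and that is not linear.\<close>

lemma not_differentiable_opT_axis:
  assumes "z \<bullet> e 1 = 0" "z \<bullet> e 2 = 0"
  shows "\<not> opT e differentiable (at z)"
proof
  assume "opT e differentiable (at z)"
  then obtain F where F: "(opT e has_derivative F) (at z)"
    unfolding differentiable_def by blast
  have "F h = opT e h" for h
    using tendsto_unique[OF _ has_derivative_imp_right_quotient[OF F] opT_quotient_axis[OF assms]]
    by simp
  then have "F = opT e" by blast
  then show False
    using has_derivative_linear[OF F] not_linear_opT by blast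
qed

lemma zero_in_coderivative_opT:
  assumes "(y \<bullet> e 1)\<^sup>2 + (y \<bullet> e 2)\<^sup>2 = 0"
  shows "0 \<in> coderivative (opT e) z y"
  using assms by (intro zero_in_coderivative_orthogonal_range)
    (simp add: opT_eq inner_add_right sum_power2_eq_zero_iff)

text \<open>\<open>w\<close> is orthogonal to the range, so 0 lies in the coderivative at
  \<open>w\<close>. With the centre \<open>x\<close> as base point it is admissible for every
  radius, so each infimum is 0 and so is their supremum.\<close>

lemma covering_constant_opT:
  assumes w: "norm w = 1" "w \<bullet> e 1 = 0" "w \<bullet> e 2 = 0"
  shows "covering_constant (opT e) x (opT e x) = 0"
proof -
  have "Inf {ereal (norm v) |v u w. v \<in> coderivative (opT e) u w \<and> u \<in> cball x \<eta> \<and>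
      opT e u \<in> cball (opT e x) \<eta> \<and> norm w = 1} = 0" if "\<eta> > 0" for \<eta>
  proof (rule antisym)
    have "0 \<in> coderivative (opT e) x w"
      using w by (intro zero_in_coderivative_opT) simp
    then show "Inf {ereal (norm v) |v u w. v \<in> coderivative (opT e) u w \<and> u \<in> cball x \<eta> \<and>
      opT e u \<in> cball (opT e x) \<eta> \<and> norm w = 1} \<le> 0"
      using w that by (intro Inf_lower) (force simp: zero_ereal_def)
  qed (auto intro!: Inf_greatest)
  then show ?thesis
    unfolding covering_constant_def by simp
qed

end

text \<open>By \<open>norm_opT\<close> each summand is the squared length of the projection of
  \<open>e i\<close> onto the plane: 1 for the first two basis vectors, 0 for all others.\<close>

lemma opT_hilbert_schmidt:
  assumes "{1, 2} \<subseteq> idx N"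
    and orth: "\<And>i j. i \<in> idx N \<Longrightarrow> j \<in> idx N \<Longrightarrow> e i \<bullet> e j = (if i = j then 1 else 0)"
  shows "quasi_hilbert_schmidt N e (opT e)" "(hs_norm N e (opT e))\<^sup>2 = 2"
proof -
  have e12: "e 1 \<bullet> e 1 = 1" "e 2 \<bullet> e 2 = 1" "e 1 \<bullet> e 2 = 0"
    using assms by simp_all
  have vals: "(norm (opT e (e i)))\<^sup>2 = (if i \<in> {1, 2} then 1 else 0)" if "i \<in> idx N" for i
    unfolding norm_opT[OF e12] using that assms by auto
  \<comment> \<open>Comparison with the finite sum over \<open>{1, 2}\<close> yields summability and
    the value at once.\<close>
  have "((\<lambda>i. (norm (opT e (e i)))\<^sup>2) has_sum 2) (idx N)
      \<longleftrightarrow> ((\<lambda>i. 1) has_sum (2::real)) {1::nat, 2}"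
    using assms by (intro has_sum_cong_neutral) (auto simp: vals)
  then have sum: "((\<lambda>i. (norm (opT e (e i)))\<^sup>2) has_sum 2) (idx N)"
    using has_sum_finite[of "{1::nat, 2}" "\<lambda>_. 1::real"] by simp
  show "quasi_hilbert_schmidt N e (opT e)"
    unfolding quasi_hilbert_schmidt_def
    using continuous_on_opT[OF e12] has_sum_imp_summable[OF sum] by blast
  show "(hs_norm N e (opT e))\<^sup>2 = 2"
    unfolding hs_norm_def infsumI[OF sum] by simp
qed

theorem theorem6p1:
  fixes e :: "nat \<Rightarrow> 'a::{real_inner, complete_space}" and N :: enat
  assumes "separable_space (euclidean :: 'a topology)"
    and "3 \<le> N"
    and "orthonormal_basis N e"
  shows
    "(\<forall>x. norm (opT e x) \<le> norm x)
     \<and> (\<not> linear (opT e) \<and> quasi_hilbert_schmidt N e (opT e) \<and> (hs_norm N e (opT e))\<^sup>2 = 2)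
     \<and> (\<forall>z. (z \<bullet> e 1)\<^sup>2 + (z \<bullet> e 2)\<^sup>2 > 0 \<longrightarrow>
          opT e differentiable (at z) \<and>
          (\<forall>x. frechet_derivative (opT e) (at z) x
                = row_basis N e (row_mult N (sc e x) (matD e z))))
     \<and> (\<forall>z. (z \<bullet> e 1)\<^sup>2 + (z \<bullet> e 2)\<^sup>2 > 0 \<longrightarrow>
          mordukhovich_differentiable (opT e) z \<and>
          (\<forall>y. coderivative (opT e) z y = {adjoint (frechet_derivative (opT e) (at z)) y} \<and>
               coderivative (opT e) z y
                 = {row_basis N e (row_mult N (sc e y) (mat_transpose (matD e z)))} \<and>
               (let z1 = z \<bullet> e 1; z2 = z \<bullet> e 2 in
                coderivative (opT e) z y
                 = {(((y \<bullet> e 1) * (z1\<^sup>2 + 3 * z2\<^sup>2) * z1 + 2 * (y \<bullet> e 2) * z2\<^sup>2 * z2)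
                      / ((z1\<^sup>2 + z2\<^sup>2) * sqrt (z1\<^sup>2 + z2\<^sup>2))) *\<^sub>R e 1
                  + ((- (y \<bullet> e 1) * (3 * z1\<^sup>2 + z2\<^sup>2) * z2 + 2 * (y \<bullet> e 2) * z1\<^sup>2 * z1)
                      / ((z1\<^sup>2 + z2\<^sup>2) * sqrt (z1\<^sup>2 + z2\<^sup>2))) *\<^sub>R e 2})))
     \<and> (\<forall>z. (z \<bullet> e 1)\<^sup>2 + (z \<bullet> e 2)\<^sup>2 > 0 \<longrightarrow>
          (\<forall>y. let z1 = z \<bullet> e 1; z2 = z \<bullet> e 2 in
             \<exists>v. coderivative (opT e) z y = {v} \<and>
               (norm v)\<^sup>2 = (y \<bullet> e 1)\<^sup>2 + (y \<bullet> e 2)\<^sup>2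
                 + 12 * ((y \<bullet> e 1) * (z1 * z2 / (z1\<^sup>2 + z2\<^sup>2))
                         - (y \<bullet> e 2) * ((z1\<^sup>2 - z2\<^sup>2) / (2 * (z1\<^sup>2 + z2\<^sup>2))))\<^sup>2))
     \<and> (\<forall>B. bounded B \<longrightarrow> compact (closure (opT e ` B)))
     \<and> (\<forall>xb yb. yb = opT e xb \<longrightarrow> covering_constant (opT e) xb yb = 0)
     \<and> (\<forall>z y. (y \<bullet> e 1)\<^sup>2 + (y \<bullet> e 2)\<^sup>2 = 0 \<longrightarrow> 0 \<in> coderivative (opT e) z y)
     \<and> (\<forall>z. (z \<bullet> e 1)\<^sup>2 + (z \<bullet> e 2)\<^sup>2 = 0 \<longrightarrow>
          \<not> mordukhovich_differentiable (opT e) z \<and>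
          (\<forall>y. (y \<bullet> e 1)\<^sup>2 + (y \<bullet> e 2)\<^sup>2 > 0 \<longrightarrow> coderivative (opT e) z y = {}))
     \<and> (\<forall>z. (z \<bullet> e 1)\<^sup>2 + (z \<bullet> e 2)\<^sup>2 = 0 \<longrightarrow> \<not> opT e differentiable (at z))"
proof -
  have idx: "{1, 2} \<subseteq> idx N" "3 \<in> idx N"
  proof -
    have "enat 3 \<le> N"
      using assms(2) by (simp add: numeral_eq_enat)
    then show "{1, 2} \<subseteq> idx N" "3 \<in> idx N"
      unfolding idx_def by (auto intro: order_trans[of _ "enat 3"])
  qed
  have orth: "e i \<bullet> e j = (if i = j then 1 else 0)" if "i \<in> idx N" "j \<in> idx N" for i j
    using assms(3) that unfolding orthonormal_basis_def by blast
  have e12: "e 1 \<bullet> e 1 = 1" "e 2 \<bullet> e 2 = 1" "e 1 \<bullet> e 2 = 0"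
    using idx by (simp_all add: orth)
  \<comment> \<open>The third basis vector is the unit vector orthogonal to the range that
    \<open>covering_constant_opT\<close> calls for; here \<open>3 \<le> N\<close> is used in
    full.\<close>
  have e3: "norm (e 3) = 1" "e 3 \<bullet> e 1 = 0" "e 3 \<bullet> e 2 = 0"
    using idx by (simp_all add: orth norm_eq_sqrt_inner)
  have axis: "z \<bullet> e 1 = 0" "z \<bullet> e 2 = 0" if "(z \<bullet> e 1)\<^sup>2 + (z \<bullet> e 2)\<^sup>2 = 0" for z
    using that by (simp_all add: sum_power2_eq_zero_iff)
  \<comment> \<open>\<open>frechet_derivative\<close> is defined by choice; uniqueness of the
    derivative identifies it with the explicit map.\<close>
  have D: "frechet_derivative (opT e) (at z) = opT_deriv e z"
    if "(z \<bullet> e 1)\<^sup>2 + (z \<bullet> e 2)\<^sup>2 > 0" for z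
    using frechet_derivative_at[OF opT_has_derivative[OF that]] by simp
  have D_matrix: "opT_deriv e z x = row_basis N e (row_mult N (sc e x) (matD e z))" for z x
    by (subst row_basis_row_mult_support[OF idx(1)])
      (rule matD_support, assumption, simp only: opT_deriv_def sc_def)
  have D_adjoint: "opT_coderiv e z y = adjoint (opT_deriv e z) y" for z y
  proof -
    \<comment> \<open>Likewise \<open>adjoint\<close> is defined by choice and pinned down by any
      map that satisfies the adjoint relation.\<close>
    have "adjoint (opT_deriv e z) = opT_coderiv e z"
      by (rule adjoint_unique) (metis opT_deriv_adjoint inner_commute)
    then show ?thesis by simp
  qed
  have D_transpose:
    "opT_coderiv e z y = row_basis N e (row_mult N (sc e y) (mat_transpose (matD e z)))" for z y
  proof -
    have "mat_transpose (matD e z) i j = 0" if "i \<notin> {1, 2} \<or> j \<notin> {1, 2}" for i j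
      unfolding mat_transpose_def using that by (intro matD_support) blast
    then show ?thesis
      by (subst row_basis_row_mult_support[OF idx(1)])
        (simp_all add: opT_coderiv_def mat_transpose_def sc_def)
  qed
  have D_explicit: "opT_coderiv e z y =
      (((y \<bullet> e 1) * (z1\<^sup>2 + 3 * z2\<^sup>2) * z1 + 2 * (y \<bullet> e 2) * z2\<^sup>2 * z2)
          / ((z1\<^sup>2 + z2\<^sup>2) * sqrt (z1\<^sup>2 + z2\<^sup>2))) *\<^sub>R e 1
      + ((- (y \<bullet> e 1) * (3 * z1\<^sup>2 + z2\<^sup>2) * z2 + 2 * (y \<bullet> e 2) * z1\<^sup>2 * z1)
          / ((z1\<^sup>2 + z2\<^sup>2) * sqrt (z1\<^sup>2 + z2\<^sup>2))) *\<^sub>R e 2"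
    if "z1 = z \<bullet> e 1" "z2 = z \<bullet> e 2" for z y z1 z2
    unfolding opT_coderiv_def matD_def Let_def that
    by (simp add: add_divide_distrib diff_divide_distrib algebra_simps)
  have not_mordukhovich: "\<not> mordukhovich_differentiable (opT e) z"
    if "(z \<bullet> e 1)\<^sup>2 + (z \<bullet> e 2)\<^sup>2 = 0" for z
  proof -
    \<comment> \<open>\<open>e 1\<close> serves as a vector with nonzero component in the plane,
      where the value is empty.\<close>
    have "coderivative (opT e) z (e 1) = {}"
      using coderivative_opT_axis_empty[OF e12 axis[OF that]] e12 by simp
    then show ?thesis
      unfolding mordukhovich_differentiable_def by blast
  qed
  show ?thesis
    unfolding Let_def
  proof (intro conjI allI impI)
    show "norm (opT e x) \<le> norm x" for x
      unfolding norm_opT[OF e12] by (rule bessel_plane[OF e12])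
    show "\<not> linear (opT e)"
      by (rule not_linear_opT[OF e12])
    show "quasi_hilbert_schmidt N e (opT e)" "(hs_norm N e (opT e))\<^sup>2 = 2"
      using opT_hilbert_schmidt[OF idx(1) orth] by blast+
    show "compact (closure (opT e ` B))" if "bounded B" for B
      using that by (rule compact_closure_opT_image[OF e12])
    show "covering_constant (opT e) xb yb = 0" if "yb = opT e xb" for xb yb
      unfolding that using e3 by (rule covering_constant_opT[OF e12])
    show "0 \<in> coderivative (opT e) z y" if "(y \<bullet> e 1)\<^sup>2 + (y \<bullet> e 2)\<^sup>2 = 0" for z y
      using that by (rule zero_in_coderivative_opT[OF e12])
  next
    fix z assume z: "(z \<bullet> e 1)\<^sup>2 + (z \<bullet> e 2)\<^sup>2 > 0"
    show "opT e differentiable (at z)"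
      using opT_has_derivative[OF z] unfolding differentiable_def by blast
    show "frechet_derivative (opT e) (at z) x
        = row_basis N e (row_mult N (sc e x) (matD e z))" for x
      unfolding D[OF z] by (rule D_matrix)
    show "mordukhovich_differentiable (opT e) z"
      unfolding mordukhovich_differentiable_def coderivative_opT[OF z] by blast
    fix y
    show "coderivative (opT e) z y = {adjoint (frechet_derivative (opT e) (at z)) y}"
      unfolding coderivative_opT[OF z] D[OF z] D_adjoint ..
    show "coderivative (opT e) z y
        = {row_basis N e (row_mult N (sc e y) (mat_transpose (matD e z)))}"
      unfolding coderivative_opT[OF z] D_transpose ..
  next
    fix z y assume z: "(z \<bullet> e 1)\<^sup>2 + (z \<bullet> e 2)\<^sup>2 > 0"
    show "coderivative (opT e) z y =
        {(((y \<bullet> e 1) * ((z \<bullet> e 1)\<^sup>2 + 3 * (z \<bullet> e 2)\<^sup>2) * (z \<bullet> e 1)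
             + 2 * (y \<bullet> e 2) * (z \<bullet> e 2)\<^sup>2 * (z \<bullet> e 2))
          / (((z \<bullet> e 1)\<^sup>2 + (z \<bullet> e 2)\<^sup>2) * sqrt ((z \<bullet> e 1)\<^sup>2 + (z \<bullet> e 2)\<^sup>2))) *\<^sub>R e 1
       + ((- (y \<bullet> e 1) * (3 * (z \<bullet> e 1)\<^sup>2 + (z \<bullet> e 2)\<^sup>2) * (z \<bullet> e 2)
             + 2 * (y \<bullet> e 2) * (z \<bullet> e 1)\<^sup>2 * (z \<bullet> e 1))
          / (((z \<bullet> e 1)\<^sup>2 + (z \<bullet> e 2)\<^sup>2) * sqrt ((z \<bullet> e 1)\<^sup>2 + (z \<bullet> e 2)\<^sup>2))) *\<^sub>R e 2}"
      unfolding coderivative_opT[OF z] D_explicit[OF refl refl] ..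
  next
    fix z y assume z: "(z \<bullet> e 1)\<^sup>2 + (z \<bullet> e 2)\<^sup>2 > 0"
    show "\<exists>v. coderivative (opT e) z y = {v} \<and>
        (norm v)\<^sup>2 = (y \<bullet> e 1)\<^sup>2 + (y \<bullet> e 2)\<^sup>2
          + 12 * ((y \<bullet> e 1) * ((z \<bullet> e 1) * (z \<bullet> e 2) / ((z \<bullet> e 1)\<^sup>2 + (z \<bullet> e 2)\<^sup>2))
            - (y \<bullet> e 2) * (((z \<bullet> e 1)\<^sup>2 - (z \<bullet> e 2)\<^sup>2)
                / (2 * ((z \<bullet> e 1)\<^sup>2 + (z \<bullet> e 2)\<^sup>2))))\<^sup>2"
      using coderivative_opT[OF z] norm_opT_coderiv[OF e12 z] by blast
  next
    fix z assume z: "(z \<bullet> e 1)\<^sup>2 + (z \<bullet> e 2)\<^sup>2 = 0"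
    show "\<not> mordukhovich_differentiable (opT e) z"
      by (rule not_mordukhovich[OF z])
    show "coderivative (opT e) z y = {}" if "(y \<bullet> e 1)\<^sup>2 + (y \<bullet> e 2)\<^sup>2 > 0" for y
      using that by (rule coderivative_opT_axis_empty[OF e12 axis[OF z]])
    show "\<not> opT e differentiable (at z)"
      by (rule not_differentiable_opT_axis[OF e12 axis[OF z]])
  qed
qed

end
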